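(* Let $r \ge 1$ be an integer and let $\psi : \mathbb{N} \to (0,\infty)$ be an arbitrary positive function such that $\min_{m\ge n}\psi(m)$ exists for every $n\in\mathbb{N}$. Let \[ F(r,\psi) = \Big\{ x \in [0,1) : \text{for infinitely many } n\in\mathbb{N} \text{ there exist } 1 \le k_1 < \cdots < k_r \le n \text{ with } a_{k_i}(x) \ge \psi(n) \text{ for } i=1,\ldots,r \Big\}. \] Then the Lebesgue measure $\mathcal{L}(F(r,\psi))$ satisfies \[ \mathcal{L}\big(F(r, \psi)\big)=\begin{cases} 0, & \text{if } \sum_{n=1}^{\infty} n^{r-1} \Big(\min_{m\geq n}\psi(m)\Big)^{-r} < \infty,\\ 1, & \text{if } \sum_{n=1}^{\infty} n^{r-1} \Big(\min_{m\geq n}\psi(m)\Big)^{-r} = \infty. \end{cases} \]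
   Context: $\mathbb{N}=\{1,2,3,\ldots\}$. The Gauss map $T:[0,1)\to[0,1)$ is $T(0)=0$ and $T(x)=1/x-\lfloor 1/x\rfloor$ for $x\in(0,1)$. The partial quotients of $x$ are $a_1(x)=\lfloor 1/x\rfloor$ and $a_{n+1}(x)=a_1(T^n(x))$ for $n\ge1$, so that $x=[a_1(x),a_2(x),\ldots]=\cfrac{1}{a_1(x)+\cfrac{1}{a_2(x)+\ddots}}$. For rational $x$ only finitely many partial quotients are defined (those with $T^{k-1}(x)\neq 0$), and a condition $a_k(x)\ge c$ is understood to require that $a_k(x)$ is defined. $\mathcal{L}$ denotes Lebesgue measure on $[0,1)$. *)

theory Defs
  imports "HOL-Analysis.Analysis"
begin

definition gauss_map :: "real \<Rightarrow> real" where
  "gauss_map x = (if x = 0 then 0 else 1 / x - of_int \<lfloor>1 / x\<rfloor>)"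

text \<open>Partial quotients are indexed from \<open>k = 1\<close>. The function \<open>partial_quotient\<close> is
  total; its value is the \<open>k\<close>-th partial quotient only under \<open>partial_quotient_defined x k\<close>,
  which fails from some \<open>k\<close> on exactly when \<open>x\<close> is rational.\<close>

definition partial_quotient_defined :: "real \<Rightarrow> nat \<Rightarrow> bool" where
  "partial_quotient_defined x k \<longleftrightarrow> 1 \<le> k \<and> (gauss_map ^^ (k - 1)) x \<noteq> 0"

definition partial_quotient :: "real \<Rightarrow> nat \<Rightarrow> int" where
  "partial_quotient x k = \<lfloor>1 / (gauss_map ^^ (k - 1)) x\<rfloor>"

text \<open>Functions on the positive integers are represented by functions on \<open>nat\<close> whose value
  at \<open>0\<close> is never used.\<close>

definition F_set :: "nat \<Rightarrow> (nat \<Rightarrow> real) \<Rightarrow> real set" where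
  "F_set r \<psi> = {x \<in> {0..<1}. infinite {n. 1 \<le> n \<and>
     (\<exists>k :: nat \<Rightarrow> nat. strict_mono_on {1..r} k \<and>
        (\<forall>i\<in>{1..r}. 1 \<le> k i \<and> k i \<le> n \<and> partial_quotient_defined x (k i) \<and>
           real_of_int (partial_quotient x (k i)) \<ge> \<psi> n))}}"

text \<open>The minimum of \<open>\<psi> m\<close> over \<open>m \<ge> n\<close>; unspecified unless \<open>has_tail_min \<psi> n\<close>.\<close>

definition has_tail_min :: "(nat \<Rightarrow> real) \<Rightarrow> nat \<Rightarrow> bool" where
  "has_tail_min \<psi> n \<longleftrightarrow> (\<exists>m\<ge>n. \<forall>j\<ge>n. \<psi> m \<le> \<psi> j)"

definition tail_min :: "(nat \<Rightarrow> real) \<Rightarrow> nat \<Rightarrow> real" where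
  "tail_min \<psi> n = (LEAST y. y \<in> \<psi> ` {n..})"

end

theory Submission
  imports Defs "HOL-Probability.Probability"
begin

text \<open>
  Since the minimum of \<open>\<psi>\<close> over \<open>m \<ge> n\<close> is attained, and the condition on the partial quotients
  becomes weaker when \<open>n\<close> grows with the threshold kept, \<open>\<psi>\<close> may be replaced by the nondecreasing
  function \<open>\<phi> n = min\<^bsub>m\<ge>n\<^esub> \<psi> m\<close>; the series is then comparable with \<open>\<Sum>j. (2 ^ j / \<phi> (2 ^ j)) ^ r\<close>.

  The only property of the partial quotients used is that, conditionally on any event depending on
  \<open>a\<^sub>1, \<dots>, a\<^sub>n\<close>, the probability of \<open>a\<^bsub>n+1\<^esub> \<ge> t\<close> lies between \<open>min 1 (1 / (2 t))\<close> and \<open>2 / t\<close>.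
  It holds because the inverse branches of the iterates of the Gauss map are Moebius maps of bounded
  distortion. The upper bound gives the convergence part by a union bound over the \<open>r\<close>-subsets of the
  indices and the Borel--Cantelli lemma along dyadic \<open>n\<close>. For the divergence part the lower bound
  shows that, whatever the past, \<open>r\<close> large partial quotients occur in a dyadic block with
  probability at least a constant multiple of \<open>min 1 ((2 ^ j / \<phi> (2 ^ j)) ^ r)\<close>, so that almost surely
  this happens in infinitely many blocks; no upper bound on correlations is needed.
\<close>

section \<open>Condensation of the series\<close>

lemma sum_dyadic_blocks:
  fixes f :: "nat \<Rightarrow> 'a::comm_monoid_add"
  shows "(\<Sum>j<J. \<Sum>n\<in>{2^j..<2^Suc j}. f n) = (\<Sum>n\<in>{1..<2^J}. f n)"
proof (induction J)
  case (Suc J)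
  have "{1..<2^Suc J} = {1..<2^J} \<union> {2^J..<2^Suc J::nat}"
    by (intro ivl_disj_un(17)[symmetric]) auto
  then have "(\<Sum>n\<in>{1..<2^Suc J}. f n) = (\<Sum>n\<in>{1..<2^J}. f n) + (\<Sum>n\<in>{2^J..<2^Suc J}. f n)"
    by (simp add: sum.union_disjoint)
  then show ?case using Suc by simp
qed simp

text \<open>For nonnegative terms summability means bounded partial sums, and each partial sum of
  either series is dominated by one of the other.\<close>

lemma summable_dyadic_blocks_iff:
  fixes f :: "nat \<Rightarrow> real"
  assumes nonneg: "\<And>n. 0 \<le> f n"
  shows "summable (\<lambda>n. f (Suc n)) \<longleftrightarrow> summable (\<lambda>j. \<Sum>n\<in>{2^j..<2^Suc j}. f n)"
proof
  assume s: "summable (\<lambda>n. f (Suc n))"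
  show "summable (\<lambda>j. \<Sum>n\<in>{2^j..<2^Suc j}. f n)"
  proof (rule summableI_nonneg_bounded)
    fix J
    have "(\<Sum>n\<in>{1..<2^J}. f n) = (\<Sum>n<2^J - 1. f (Suc n))"
      by (rule sum.reindex_bij_witness[of _ Suc "\<lambda>n. n - 1"]) auto
    also have "\<dots> \<le> (\<Sum>n. f (Suc n))"
      by (rule sum_le_suminf[OF s]) (auto simp: nonneg)
    finally show "(\<Sum>j<J. \<Sum>n\<in>{2^j..<2^Suc j}. f n) \<le> (\<Sum>n. f (Suc n))"
      by (simp only: sum_dyadic_blocks)
  qed (simp add: sum_nonneg nonneg)
next
  assume s: "summable (\<lambda>j. \<Sum>n\<in>{2^j..<2^Suc j}. f n)"
  show "summable (\<lambda>n. f (Suc n))"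
  proof (rule summableI_nonneg_bounded)
    fix J
    have "J \<le> 2^J - 1" using less_exp[of J] by linarith
    then have "(\<Sum>n<J. f (Suc n)) \<le> (\<Sum>n<2^J - 1. f (Suc n))"
      by (intro sum_mono2) (auto simp: nonneg)
    also have "\<dots> = (\<Sum>n\<in>{1..<2^J}. f n)"
      by (rule sum.reindex_bij_witness[of _ "\<lambda>n. n - 1" Suc]) auto
    also have "\<dots> = (\<Sum>j<J. \<Sum>n\<in>{2^j..<2^Suc j}. f n)"
      by (simp only: sum_dyadic_blocks)
    also have "\<dots> \<le> (\<Sum>j. \<Sum>n\<in>{2^j..<2^Suc j}. f n)"
      by (rule sum_le_suminf[OF s]) (auto intro!: sum_nonneg nonneg)
    finally show "(\<Sum>n<J. f (Suc n)) \<le> (\<Sum>j. \<Sum>n\<in>{2^j..<2^Suc j}. f n)" .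
  qed (simp add: nonneg)
qed

text \<open>Cauchy condensation: on a dyadic block \<open>n ^ (r - 1)\<close> varies by a bounded
  factor, \<open>\<phi> n\<close> is compared with an endpoint value, and the number
  \<open>2 ^ j\<close> of terms supplies the missing power.\<close>

lemma summable_power_condensation_iff:
  fixes \<phi> :: "nat \<Rightarrow> real"
  assumes r: "r \<ge> 1" and pos: "\<And>n. n \<ge> 1 \<Longrightarrow> \<phi> n > 0"
    and mono: "\<And>m n. 1 \<le> m \<Longrightarrow> m \<le> n \<Longrightarrow> \<phi> m \<le> \<phi> n"
  shows "summable (\<lambda>n. real (Suc n) ^ (r - 1) * \<phi> (Suc n) powi (- int r)) \<longleftrightarrow>
    summable (\<lambda>j. (2 ^ j / \<phi> (2 ^ j)) ^ r)"
proof -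
  \<comment> \<open>The value 0 at index 0 makes \<open>f\<close> nonnegative everywhere; nothing is
    assumed about \<open>\<phi> 0\<close>.\<close>
  define f where "f n = (if n = 0 then 0 else real n ^ (r - 1) / \<phi> n ^ r)" for n
  define g where "g j = (2 ^ j / \<phi> (2 ^ j)) ^ r" for j :: nat
  define B where "B j = (\<Sum>n\<in>{2^j..<2^Suc j}. f n)" for j
  have f0: "0 \<le> f n" for n
    using pos[of n] by (auto simp: f_def intro!: divide_nonneg_nonneg)
  have g0: "0 \<le> g j" for j
    using pos[of "2^j"] by (auto simp: g_def intro!: divide_nonneg_nonneg)
  have pw: "x * x ^ (r - 1) = x ^ r" for x :: real
    using r by (metis Suc_diff_1 less_eq_Suc_le power_Suc One_nat_def)
  have fS: "real (Suc n) ^ (r - 1) * \<phi> (Suc n) powi (- int r) = f (Suc n)" for n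
    by (simp add: f_def power_int_minus divide_inverse)
  \<comment> \<open>An upper bound for \<open>\<phi>\<close> on the block is its value at the right
    endpoint, hence the shift to \<open>g (Suc j)\<close>.\<close>
  have lower: "(1/2) ^ r * g (Suc j) \<le> B j" for j
  proof -
    have "(1/2) ^ r * g (Suc j) = 2^j * ((2^j) ^ (r - 1) / \<phi> (2 ^ Suc j) ^ r)"
      by (simp add: g_def power_divide power_mult_distrib pw field_simps flip: pw[of "2^j"])
    also have "\<dots> = (\<Sum>n\<in>{2^j..<2^Suc j::nat}. (2^j) ^ (r - 1) / \<phi> (2 ^ Suc j) ^ r)"
      by simp
    also have "\<dots> \<le> B j"
      unfolding B_def
    proof (rule sum_mono)
      fix n :: nat assume n: "n \<in> {2^j..<2^Suc j}"
      have n1: "n \<ge> 1" using n by (meson atLeastLessThan_iff le_trans one_le_numeral one_le_power)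
      have "real (2^j) \<le> real n" using n by (subst of_nat_le_iff) simp
      then show "(2^j) ^ (r - 1) / \<phi> (2 ^ Suc j) ^ r \<le> f n"
        using n n1 pos[of n] mono[of n "2^Suc j"]
        by (auto simp: f_def intro!: frac_le power_mono)
    qed
    finally show ?thesis .
  qed
  have upper: "B j \<le> 2 ^ r * g j" for j
  proof -
    have "B j \<le> (\<Sum>n\<in>{2^j..<2^Suc j::nat}. (2^Suc j) ^ (r - 1) / \<phi> (2 ^ j) ^ r)"
      unfolding B_def
    proof (rule sum_mono)
      fix n :: nat assume n: "n \<in> {2^j..<2^Suc j}"
      have n1: "n \<ge> 1" using n by (meson atLeastLessThan_iff le_trans one_le_numeral one_le_power)
      have "real n \<le> real (2^Suc j)" using n by (subst of_nat_le_iff) simp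
      then show "f n \<le> (2^Suc j) ^ (r - 1) / \<phi> (2 ^ j) ^ r"
        using n n1 pos[of n] pos[of "2^j"] mono[of "2^j" n]
        unfolding f_def by (subst if_not_P) (linarith, intro frac_le power_mono, auto)
    qed
    also have "\<dots> = 2 ^ j * ((2^Suc j) ^ (r - 1) / \<phi> (2 ^ j) ^ r)"
      by simp
    \<comment> \<open>Doubling the number of terms lets it merge with the power \<open>r - 1\<close>
      of \<open>2 ^ Suc j\<close>.\<close>
    also have "\<dots> \<le> 2 ^ Suc j * ((2^Suc j) ^ (r - 1) / \<phi> (2 ^ j) ^ r)"
      using pos[of "2^j"] by (intro mult_right_mono) (auto intro!: divide_nonneg_nonneg)
    also have "\<dots> = (2^Suc j) ^ r / \<phi> (2 ^ j) ^ r"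
      by (subst pw[symmetric]) simp
    also have "\<dots> = 2 ^ r * g j"
      by (simp add: g_def power_divide power_mult_distrib)
    finally show ?thesis .
  qed
  have "summable B \<longleftrightarrow> summable g"
  proof
    assume "summable B"
    then have "summable (\<lambda>j. (1/2) ^ r * g (Suc j))"
      by (rule summable_comparison_test'[where N = 0]) (use lower g0 in auto)
    then show "summable g"
      by (simp add: summable_Suc_iff)
  next
    assume "summable g"
    then have "summable (\<lambda>j. 2 ^ r * g j)" by (rule summable_mult)
    then show "summable B"
      by (rule summable_comparison_test'[where N = 0])
        (use upper in \<open>auto simp: B_def sum_nonneg f0\<close>)
  qed
  moreover have "summable B \<longleftrightarrow> summable (\<lambda>n. f (Suc n))"
    unfolding B_def by (rule summable_dyadic_blocks_iff[symmetric, OF f0])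
  ultimately show ?thesis by (simp only: fS g_def[abs_def])
qed

section \<open>Digit processes with conditional tail bounds\<close>

text \<open>These sets are the arbitrary unions of fibres of \<open>(a 1, ..., a n)\<close>.
  Measurability is not built in and enters separately as \<open>events_determined\<close>.\<close>

definition determined :: "'a set \<Rightarrow> (nat \<Rightarrow> 'a \<Rightarrow> 'b) \<Rightarrow> nat \<Rightarrow> 'a set \<Rightarrow> bool" where
  "determined \<Omega> a n S \<longleftrightarrow>
     S \<subseteq> \<Omega> \<and> (\<forall>x\<in>S. \<forall>y\<in>\<Omega>. (\<forall>i\<in>{1..n}. a i y = a i x) \<longrightarrow> y \<in> S)"

lemma determined_space: "determined \<Omega> a n \<Omega>"
  by (simp add: determined_def)

lemma determined_mono: "determined \<Omega> a m S \<Longrightarrow> m \<le> n \<Longrightarrow> determined \<Omega> a n S"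
  by (fastforce simp: determined_def)

lemma determined_Collect:
  assumes "determined \<Omega> a n S"
    and "\<And>x y. \<lbrakk>x \<in> \<Omega>; y \<in> \<Omega>; \<And>i. 1 \<le> i \<Longrightarrow> i \<le> n \<Longrightarrow> a i y = a i x; P x\<rbrakk> \<Longrightarrow> P y"
  shows "determined \<Omega> a n {x\<in>S. P x}"
  unfolding determined_def
proof (intro conjI ballI impI)
  fix x y assume x: "x \<in> {x\<in>S. P x}" and y: "y \<in> \<Omega>" and e: "\<forall>i\<in>{1..n}. a i y = a i x"
  have "y \<in> S" using assms(1) x y e unfolding determined_def by blast
  moreover have "P y" using assms x y e unfolding determined_def by (intro assms(2)[of x y]) auto
  ultimately show "y \<in> {x\<in>S. P x}" by simp
qed (use assms(1) in \<open>auto simp: determined_def\<close>)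

text \<open>Combines \<open>exp z >= 1 + z\<close> with \<open>(1 - z / 2) * (1 + z) >= 1\<close>
  for z in \<open>[0, 1]\<close>. It turns a bound on failure into a linear bound on
  success.\<close>

lemma exp_minus_le_min:
  fixes y :: real
  assumes "0 \<le> y"
  shows "exp (- y) \<le> 1 - min 1 y / 2"
proof -
  let ?z = "min 1 y"
  have "exp (- y) \<le> exp (- ?z)" by simp
  also have "\<dots> \<le> 1 / (1 + ?z)"
    using exp_ge_add_one_self[of ?z] assms by (simp add: exp_minus field_simps)
  also have "\<dots> \<le> 1 - ?z / 2"
  proof -
    have "0 \<le> ?z * (1 - ?z)" using assms by simp
    then have "1 \<le> (1 - ?z / 2) * (1 + ?z)"
      using assms by (simp only: algebra_simps)
    then show ?thesis using assms by (subst pos_divide_le_eq) auto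
  qed
  finally show ?thesis .
qed

lemma diff_le_complement_mult:
  fixes c p q :: real
  assumes "c * p \<le> q"
  shows "p - q \<le> (1 - c) * p"
  using assms by (simp add: left_diff_distrib)

text \<open>Products with \<open>prob S\<close> in place of conditional probabilities include null
  sets \<open>S\<close>. The minimum is there because \<open>1 / (2 * t)\<close> exceeds 1 for
  \<open>t < 1 / 2\<close>.\<close>

locale digit_process = prob_space M for M :: "'a measure" +
  fixes a :: "nat \<Rightarrow> 'a \<Rightarrow> real"
  assumes events_determined: "determined (space M) a n S \<Longrightarrow> S \<in> events"
    and tail_lower: "determined (space M) a n S \<Longrightarrow> t > 0 \<Longrightarrow>
      min 1 (1 / (2 * t)) * prob S \<le> prob {x\<in>S. t \<le> a (Suc n) x}"
    and tail_upper: "determined (space M) a n S \<Longrightarrow> t > 0 \<Longrightarrow>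
      prob {x\<in>S. t \<le> a (Suc n) x} \<le> 2 / t * prob S"
begin

abbreviation "dtm \<equiv> determined (space M) a"

section \<open>Convergence half for digit processes\<close>

lemma prob_all_ge_le:
  assumes "finite K" "0 \<notin> K" "t > 0"
  shows "prob {x\<in>space M. \<forall>k\<in>K. t \<le> a k x} \<le> (2 / t) ^ card K"
  using assms(1,2)
\<comment> \<open>Indices are adjoined in increasing order, so the earlier conditions depend only on
  digits before the newest index \<open>b\<close>, and \<open>tail_upper\<close> applies.\<close>
proof (induction K rule: finite_linorder_max_induct)
  case (insert b A)
  let ?S = "{x\<in>space M. \<forall>k\<in>A. t \<le> a k x}"
  have b: "Suc (b - 1) = b" using insert by auto
  have d: "dtm (b - 1) ?S"
  proof (rule determined_Collect[OF determined_space])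
    fix x y assume e: "\<And>i. 1 \<le> i \<Longrightarrow> i \<le> b - 1 \<Longrightarrow> a i y = a i x" and "\<forall>k\<in>A. t \<le> a k x"
    show "\<forall>k\<in>A. t \<le> a k y"
    proof
      fix k assume k: "k \<in> A"
      then have "1 \<le> k" "k \<le> b - 1" using insert by (auto simp: Suc_le_eq intro: gr0I)
      then show "t \<le> a k y" using e[of k] \<open>\<forall>k\<in>A. t \<le> a k x\<close> k by simp
    qed
  qed
  have "{x\<in>space M. \<forall>k\<in>insert b A. t \<le> a k x} = {x\<in>?S. t \<le> a (Suc (b - 1)) x}"
    unfolding b by auto
  also have "prob \<dots> \<le> 2 / t * prob ?S"
    by (rule tail_upper[OF d \<open>t > 0\<close>])
  also have "\<dots> \<le> 2 / t * (2 / t) ^ card A"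
    using insert \<open>t > 0\<close> by (intro mult_left_mono) auto
  also have "\<dots> = (2 / t) ^ card (insert b A)"
    using insert by (subst card_insert_disjoint) auto
  finally show ?case .
qed simp

lemma events_ge:
  assumes "finite K" "0 \<notin> K"
  shows "{x\<in>space M. \<forall>k\<in>K. t \<le> a k x} \<in> events"
\<comment> \<open>Inserting 0 gives \<open>Max\<close> a value also when \<open>K\<close> is
  empty.\<close>
proof (rule events_determined, rule determined_Collect[OF determined_space])
  fix x y assume e: "\<And>i. 1 \<le> i \<Longrightarrow> i \<le> Max (insert 0 K) \<Longrightarrow> a i y = a i x"
    and "\<forall>k\<in>K. t \<le> a k x"
  moreover have "1 \<le> k" "k \<le> Max (insert 0 K)" if "k \<in> K" for k
    using that assms by (auto simp: Suc_le_eq intro!: Max_ge gr0I)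
  ultimately show "\<forall>k\<in>K. t \<le> a k y" by metis
qed

lemma prob_ex_subset_le:
  fixes N r :: nat
  assumes "t > 0"
  defines "E \<equiv> {x\<in>space M. \<exists>K\<subseteq>{1..N}. card K = r \<and> (\<forall>k\<in>K. t \<le> a k x)}"
  shows "E \<in> events" "prob E \<le> (2 * N / t) ^ r"
proof -
  let ?I = "{K. K \<subseteq> {1..N} \<and> card K = r}"
  have fin: "finite ?I" by simp
  have K: "finite K" "0 \<notin> K" "card K = r" if "K \<in> ?I" for K
    using that by (auto intro: finite_subset)
  have E: "E = (\<Union>K\<in>?I. {x\<in>space M. \<forall>k\<in>K. t \<le> a k x})"
    unfolding E_def by blast
  have ev: "{x\<in>space M. \<forall>k\<in>K. t \<le> a k x} \<in> events" if "K \<in> ?I" for K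
    using K[OF that] by (intro events_ge)
  show "E \<in> events"
    unfolding E using fin ev by (intro sets.finite_UN) auto
  have "prob E \<le> (\<Sum>K\<in>?I. prob {x\<in>space M. \<forall>k\<in>K. t \<le> a k x})"
    unfolding E using fin ev by (intro finite_measure_subadditive_finite) auto
  also have "\<dots> \<le> (\<Sum>K\<in>?I. (2 / t) ^ r)"
  proof (rule sum_mono)
    fix J assume J: "J \<in> ?I"
    show "prob {x\<in>space M. \<forall>k\<in>J. t \<le> a k x} \<le> (2 / t) ^ r"
      using prob_all_ge_le[OF K(1,2)[OF J] assms(1)] unfolding K(3)[OF J] .
  qed
  also have "\<dots> = real (N choose r) * (2 / t) ^ r"
    by (subst sum_constant, subst n_subsets) auto
  also have "\<dots> \<le> real N ^ r * (2 / t) ^ r"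
  proof (rule mult_right_mono)
    show "real (N choose r) \<le> real N ^ r"
    proof (cases "r \<le> N")
      case True
      then show ?thesis using binomial_le_pow[of r N] by (metis of_nat_le_iff of_nat_power)
    qed (simp add: binomial_eq_0)
  qed (use assms(1) in auto)
  also have "\<dots> = (2 * N / t) ^ r"
    by (simp add: power_divide power_mult_distrib)
  finally show "prob E \<le> (2 * N / t) ^ r" .
qed

theorem AE_finitely_often:
  fixes \<phi> :: "nat \<Rightarrow> real"
  assumes pos: "\<And>n. n \<ge> 1 \<Longrightarrow> \<phi> n > 0"
    and mono: "\<And>m n. 1 \<le> m \<Longrightarrow> m \<le> n \<Longrightarrow> \<phi> m \<le> \<phi> n"
    and sum: "summable (\<lambda>j. (2 ^ j / \<phi> (2 ^ j)) ^ r)"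
  shows "AE x in M. \<not> (\<exists>\<^sub>\<infinity>n. \<exists>K\<subseteq>{1..n}. card K = r \<and> (\<forall>k\<in>K. \<phi> n \<le> a k x))"
proof -
  \<comment> \<open>\<open>E j\<close> handles all \<open>n\<close> with
    \<open>2 ^ j <= n < 2 ^ Suc j\<close> at once: its index range contains theirs and, by
    monotonicity, its threshold is the lowest.\<close>
  define E where "E j = {x\<in>space M. \<exists>K\<subseteq>{1..2 ^ Suc j}. card K = r \<and> (\<forall>k\<in>K. \<phi> (2 ^ j) \<le> a k x)}"
    for j :: nat
  have p: "\<phi> (2 ^ j) > 0" for j by (simp add: pos)
  have ev: "E j \<in> events" for j
    unfolding E_def by (rule prob_ex_subset_le[OF p])
  \<comment> \<open>The 4 is a 2 from the tail bound times a 2 from the range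
    \<open>2 ^ Suc j\<close>.\<close>
  have "prob (E j) \<le> 4 ^ r * (2 ^ j / \<phi> (2 ^ j)) ^ r" for j
    using prob_ex_subset_le(2)[OF p, where N = "2 ^ Suc j" and r = r] unfolding E_def
    by (simp add: power_mult_distrib[symmetric])
  then have "summable (\<lambda>j. prob (E j))"
    by (intro summable_comparison_test'[OF summable_mult[OF sum, of "4 ^ r"], where N = 0]) simp
  then have "AE x in M. eventually (\<lambda>j. x \<in> space M - E j) sequentially"
    by (intro borel_cantelli_AE1 ev) (auto simp: emeasure_eq_measure)
  then show ?thesis
  proof (rule AE_mp, intro AE_I2 impI notI)
    fix x assume x: "x \<in> space M" and e: "\<forall>\<^sub>F j in sequentially. x \<in> space M - E j"
      and inf: "\<exists>\<^sub>\<infinity>n. \<exists>K\<subseteq>{1..n}. card K = r \<and> (\<forall>k\<in>K. \<phi> n \<le> a k x)"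
    obtain J where J: "\<And>j. j \<ge> J \<Longrightarrow> x \<notin> E j"
      using e unfolding eventually_sequentially by auto
    obtain n K where n: "n > 2 ^ J" and K: "K \<subseteq> {1..n}" "card K = r" "\<forall>k\<in>K. \<phi> n \<le> a k x"
      using inf unfolding INFM_nat by blast
    obtain j where j: "2 ^ j \<le> n" "n < 2 ^ Suc j"
      using ex_power_ivl1[of 2 n] n by auto
    have "2 ^ J < (2::nat) ^ Suc j" using n j by linarith
    then have "J \<le> j" by (simp only: power_strict_increasing_iff one_less_numeral_iff semiring_norm less_Suc_eq_le)
    moreover have "x \<in> E j"
    proof -
      have "K \<subseteq> {1..2 ^ Suc j}" using K j by fastforce
      moreover have "\<forall>k\<in>K. \<phi> (2 ^ j) \<le> a k x"
        using K mono[of "2 ^ j" n] j by fastforce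
      ultimately show ?thesis using K x unfolding E_def by blast
    qed
    ultimately show False using J by blast
  qed
qed

section \<open>Divergence half for digit processes\<close>

lemma prob_none_ge_le:
  assumes S: "dtm n S" and t: "t > 0"
  shows "prob {x\<in>S. \<forall>k\<in>{n<..n+m}. \<not> t \<le> a k x} \<le> (1 - min 1 (1 / (2 * t))) ^ m * prob S"
proof (induction m)
  case (Suc m)
  let ?q = "min 1 (1 / (2 * t))"
  let ?S = "{x\<in>S. \<forall>k\<in>{n<..n+m}. \<not> t \<le> a k x}"
  have d: "dtm (n + m) ?S"
    by (rule determined_Collect[OF determined_mono[OF S]]) auto
  have d': "dtm (Suc (n + m)) {x\<in>?S. t \<le> a (Suc (n + m)) x}"
    by (rule determined_Collect[OF determined_mono[OF d]]) auto
  \<comment> \<open>Splitting off the last index gives a difference of events, in which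
    \<open>tail_lower\<close> removes at least the fraction \<open>?q\<close> of
    \<open>?S\<close>.\<close>
  have eq: "{x\<in>S. \<forall>k\<in>{n<..n+Suc m}. \<not> t \<le> a k x} = ?S - {x\<in>?S. t \<le> a (Suc (n + m)) x}"
    by (auto simp: le_Suc_eq)
  have "prob {x\<in>S. \<forall>k\<in>{n<..n+Suc m}. \<not> t \<le> a k x} = prob ?S - prob {x\<in>?S. t \<le> a (Suc (n + m)) x}"
    unfolding eq by (rule finite_measure_Diff[OF events_determined[OF d] events_determined[OF d']]) blast
  also have "\<dots> \<le> (1 - ?q) * prob ?S"
    by (rule diff_le_complement_mult[OF tail_lower[OF d t]])
  also have "\<dots> \<le> (1 - ?q) * ((1 - ?q) ^ m * prob S)"
    by (rule mult_left_mono[OF Suc]) auto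
  finally show ?case by (simp only: power_Suc mult.assoc)
qed simp

text \<open>With q the single-digit bound, all \<open>m\<close> digits fail with conditional
  probability at most \<open>(1 - q) ^ m <= exp (- (m * q))\<close>, to which
  \<open>exp_minus_le_min\<close> applies.\<close>

lemma prob_some_ge_ge:
  assumes S: "dtm n S" and t: "t > 0" and m: "m \<ge> 1"
  shows "min 1 (m / (2 * t)) / 2 * prob S \<le> prob {x\<in>S. \<exists>k\<in>{n<..n+m}. t \<le> a k x}"
proof -
  let ?q = "min 1 (1 / (2 * t))"
  have q: "0 \<le> ?q" "?q \<le> 1" using t by auto
  have d: "dtm (n + m) {x\<in>S. \<forall>k\<in>{n<..n+m}. \<not> t \<le> a k x}"
    by (rule determined_Collect[OF determined_mono[OF S]]) auto
  have "(1 - ?q) ^ m \<le> exp (- ?q) ^ m"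
    using q exp_ge_add_one_self[of "- ?q"] by (intro power_mono) auto
  also have "\<dots> = exp (- (m * ?q))"
    by (simp add: exp_of_nat_mult[symmetric])
  also have "\<dots> \<le> 1 - min 1 (m * ?q) / 2"
    using q by (intro exp_minus_le_min) auto
  also have "\<dots> \<le> 1 - min 1 (m / (2 * t)) / 2"
  proof -
    \<comment> \<open>The factor \<open>m >= 1\<close> moves the inner cap from 1 to
      \<open>m\<close>, where the outer cap at 1 absorbs it.\<close>
    have "real m * ?q = min m (m / (2 * t))"
      using m by (simp add: min_mult_distrib_left)
    then show ?thesis using m by (auto simp: min_def)
  qed
  finally have *: "(1 - ?q) ^ m * prob S \<le> (1 - min 1 (m / (2 * t)) / 2) * prob S"
    by (rule mult_right_mono) simp
  have "{x\<in>S. \<exists>k\<in>{n<..n+m}. t \<le> a k x} = S - {x\<in>S. \<forall>k\<in>{n<..n+m}. \<not> t \<le> a k x}"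
    by auto
  also have "prob \<dots> = prob S - prob {x\<in>S. \<forall>k\<in>{n<..n+m}. \<not> t \<le> a k x}"
    by (rule finite_measure_Diff[OF events_determined[OF S] events_determined[OF d]]) blast
  finally show ?thesis
    using * prob_none_ge_le[OF S t, of m] by (simp add: left_diff_distrib)
qed

text \<open>What happens in the earlier sub-blocks is determined before the next one begins, so
  \<open>prob_some_ge_ge\<close> can be iterated. This replaces independence.\<close>

lemma prob_all_subblocks_ge:
  assumes S: "dtm n S" and t: "t > 0" and m: "m \<ge> 1"
  shows "(min 1 (m / (2 * t)) / 2) ^ r * prob S
    \<le> prob {x\<in>S. \<forall>i<r. \<exists>k\<in>{n+i*m<..n+i*m+m}. t \<le> a k x}"
proof (induction r)
  case (Suc r)
  let ?c = "min 1 (m / (2 * t)) / 2"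
  let ?S = "{x\<in>S. \<forall>i<r. \<exists>k\<in>{n+i*m<..n+i*m+m}. t \<le> a k x}"
  have d: "dtm (n + r * m) ?S"
  proof (rule determined_Collect[OF determined_mono[OF S]])
    fix x y assume e: "\<And>i. 1 \<le> i \<Longrightarrow> i \<le> n + r * m \<Longrightarrow> a i y = a i x"
      and h: "\<forall>i<r. \<exists>k\<in>{n+i*m<..n+i*m+m}. t \<le> a k x"
    show "\<forall>i<r. \<exists>k\<in>{n+i*m<..n+i*m+m}. t \<le> a k y"
    proof (intro allI impI)
      fix i assume i: "i < r"
      then obtain k where k: "k \<in> {n+i*m<..n+i*m+m}" "t \<le> a k x" using h by blast
      have "Suc i * m \<le> r * m" using i by (intro mult_le_mono1) simp
      then have "a k y = a k x" using k by (intro e) auto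
      then show "\<exists>k\<in>{n+i*m<..n+i*m+m}. t \<le> a k y" using k by (intro bexI[of _ k]) auto
    qed
  qed simp
  have "?c ^ Suc r * prob S = ?c * (?c ^ r * prob S)" by simp
  also have "\<dots> \<le> ?c * prob ?S"
    using t by (intro mult_left_mono[OF Suc]) auto
  also have "\<dots> \<le> prob {x\<in>?S. \<exists>k\<in>{n+r*m<..n+r*m+m}. t \<le> a k x}"
    by (rule prob_some_ge_ge[OF d t m])
  also have "{x\<in>?S. \<exists>k\<in>{n+r*m<..n+r*m+m}. t \<le> a k x} =
      {x\<in>S. \<forall>i<Suc r. \<exists>k\<in>{n+i*m<..n+i*m+m}. t \<le> a k x}"
    by (auto simp: less_Suc_eq)
  finally show ?case .
qed simp

text \<open>A second Borel-Cantelli lemma without independence: since \<open>p j\<close> bounds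
  success from below on every past event, failure along \<open>J, ..., J + m - 1\<close> has
  probability at most a product of factors \<open>1 - p j <= exp (- p j)\<close>, which divergence
  drives to 0.\<close>

lemma conditional_borel_cantelli:
  fixes N :: "nat \<Rightarrow> nat" and A :: "nat \<Rightarrow> 'a \<Rightarrow> bool" and p :: "nat \<Rightarrow> real"
  assumes N: "\<And>j. N j \<le> N (Suc j)"
    and A: "\<And>j. dtm (N (Suc j)) {x\<in>space M. A j x}"
    and p: "\<And>j S. dtm (N j) S \<Longrightarrow> p j * prob S \<le> prob {x\<in>S. A j x}"
    and p01: "\<And>j. 0 \<le> p j" "\<And>j. p j \<le> 1" and div: "\<not> summable p"
  shows "AE x in M. \<exists>\<^sub>\<infinity>j. A j x"
proof -
  have Nmono: "N i \<le> N j" if "i \<le> j" for i j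
    using N that by (rule lift_Suc_mono_le)
  have A': "A j y" if "dtm n {x\<in>space M. A j x}" "x \<in> space M" "y \<in> space M"
      "\<And>i. 1 \<le> i \<Longrightarrow> i \<le> n \<Longrightarrow> a i y = a i x" "A j x" for j n x y
    using that unfolding determined_def by (auto simp: Ball_def)
  \<comment> \<open>Determinedness is carried along because \<open>p\<close> applies only to
    determined events.\<close>
  have bound: "dtm (N (J + m)) {x\<in>space M. \<forall>j\<in>{J..<J+m}. \<not> A j x} \<and>
      prob {x\<in>space M. \<forall>j\<in>{J..<J+m}. \<not> A j x} \<le> exp (- (\<Sum>j<m. p (J + j)))" for J m
  proof (induction m)
    case 0
    then show ?case by (simp add: determined_space prob_space)
  next
    case (Suc m)
    let ?S = "{x\<in>space M. \<forall>j\<in>{J..<J+m}. \<not> A j x}"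
    have d: "dtm (N (J + m)) ?S" using Suc by simp
    let ?S' = "{x\<in>space M. \<forall>j\<in>{J..<J+Suc m}. \<not> A j x}"
    have eq: "?S' = {x\<in>?S. \<not> A (J + m) x}"
      by (auto simp: less_Suc_eq)
    have d1: "dtm (N (J + Suc m)) ?S"
      by (rule determined_mono[OF d]) (simp add: N)
    have dA: "dtm (N (J + Suc m)) {x\<in>space M. A (J + m) x}"
      using A[of "J + m"] by simp
    \<comment> \<open>Failure of \<open>A\<close> passes from one point to the other by
      \<open>A'\<close> with the points exchanged.\<close>
    have d2: "dtm (N (J + Suc m)) {x\<in>?S. \<not> A (J + m) x}"
      by (rule determined_Collect[OF d1], rule notI, erule notE, rule A'[OF dA]) simp_all
    have d3: "dtm (N (J + Suc m)) {x\<in>?S. A (J + m) x}"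
      by (rule determined_Collect[OF d1], rule A'[OF dA])
    have eq': "?S' = ?S - {x\<in>?S. A (J + m) x}" unfolding eq by auto
    have "prob ?S' = prob ?S - prob {x\<in>?S. A (J + m) x}"
      unfolding eq' by (rule finite_measure_Diff[OF events_determined[OF d] events_determined[OF d3]]) blast
    also have "\<dots> \<le> (1 - p (J + m)) * prob ?S"
      by (rule diff_le_complement_mult[OF p[OF d]])
    also have "\<dots> \<le> exp (- p (J + m)) * exp (- (\<Sum>j<m. p (J + j)))"
      using exp_ge_add_one_self[of "- p (J + m)"]
      by (intro mult_mono conjunct2[OF Suc] exp_ge_zero measure_nonneg) simp
    also have "\<dots> = exp (- (\<Sum>j<Suc m. p (J + j)))"
      by (simp add: exp_add[symmetric] add.commute)
    finally show ?case using d2 unfolding eq by (rule conjI[rotated])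
  qed
  have null: "AE x in M. \<exists>j\<ge>J. A j x" for J
  proof -
    let ?Z = "{x\<in>space M. \<forall>j\<ge>J. \<not> A j x}"
    have Z: "?Z = (\<Inter>m. {x\<in>space M. \<forall>j\<in>{J..<J+m}. \<not> A j x})"
    proof (intro equalityI subsetI)
      fix x assume x: "x \<in> (\<Inter>m. {x\<in>space M. \<forall>j\<in>{J..<J+m}. \<not> A j x})"
      have "\<not> A j x" if "j \<ge> J" for j
        using x[THEN INT_D, OF UNIV_I, of "Suc j"] that by auto
      then show "x \<in> ?Z" using x by auto
    qed auto
    have ev: "?Z \<in> events"
      unfolding Z by (intro sets.countable_INT) (auto intro: events_determined conjunct1[OF bound])
    have "prob ?Z \<le> e" if "e > 0" for e
    proof -
      \<comment> \<open>By divergence some partial sum exceeds \<open>- ln e\<close>, which makes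
        the exponential bound smaller than \<open>e\<close>.\<close>
      have "\<not> summable (\<lambda>j. p (J + j))"
        using div by (subst add.commute) (simp only: summable_iff_shift not_False_eq_True)
      then have "\<not> (\<forall>m. (\<Sum>j<m. p (J + j)) \<le> - ln e)"
        using summableI_nonneg_bounded[of "\<lambda>j. p (J + j)" "- ln e"] p01 by blast
      then obtain m where "(\<Sum>j<m. p (J + j)) > - ln e" by (auto simp: not_le)
      then have "exp (- (\<Sum>j<m. p (J + j))) < exp (ln e)" by simp
      moreover have "prob ?Z \<le> prob {x\<in>space M. \<forall>j\<in>{J..<J+m}. \<not> A j x}"
        by (rule finite_measure_mono) (auto intro: events_determined conjunct1[OF bound])
      ultimately show ?thesis using conjunct2[OF bound[of J m]] that by simp
    qed
    then have "prob ?Z \<le> 0" by (rule field_le_epsilon) auto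
    then have "prob ?Z = 0" by (rule antisym[OF _ measure_nonneg])
    then have "?Z \<in> null_sets M"
      by (intro null_setsI ev) (simp only: emeasure_eq_measure ennreal_0)
    then show ?thesis by (rule AE_I') auto
  qed
  then have "\<forall>J. AE x in M. \<exists>j\<ge>J. A j x" ..
  then have "AE x in M. \<forall>J. \<exists>j\<ge>J. A j x" by (rule AE_all_countable[THEN iffD2])
  then show ?thesis by (simp only: INFM_nat_le)
qed

text \<open>Block \<open>j\<close> consists of \<open>r\<close> consecutive sub-blocks of length \<open>2 ^ j\<close> after the index \<open>2 ^ (r + j)\<close>.
  Because \<open>r \<le> 2 ^ r\<close>, it ends before block \<open>j + 1\<close> begins. One large digit per sub-block
  makes \<open>r\<close> of them.\<close>

theorem AE_infinitely_often:
  fixes \<phi> :: "nat \<Rightarrow> real"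
  assumes pos: "\<And>n. n \<ge> 1 \<Longrightarrow> \<phi> n > 0"
    and div: "\<not> summable (\<lambda>j. (2 ^ j / \<phi> (2 ^ j)) ^ r)"
  shows "AE x in M. \<exists>\<^sub>\<infinity>n. \<exists>k. strict_mono_on {1..r} k \<and>
    (\<forall>i\<in>{1..r}. 1 \<le> k i \<and> k i \<le> n \<and> \<phi> n \<le> a (k i) x)"
proof -
  define N :: "nat \<Rightarrow> nat" where "N j = 2 ^ (r + j)" for j
  \<comment> \<open>The \<open>n\<close> belonging to block \<open>j\<close> will be
    \<open>N (Suc j)\<close>, which no index of the block exceeds; the threshold is taken
    there.\<close>
  define t where "t j = \<phi> (N (Suc j))" for j
  define A where "A j x \<longleftrightarrow> (\<forall>i<r. \<exists>k\<in>{N j+i*2^j<..N j+i*2^j+2^j}. t j \<le> a k x)" for j x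
  define p where "p j = (min 1 (2 ^ j / (2 * t j)) / 2) ^ r" for j
  have t: "t j > 0" for j by (simp add: t_def N_def pos)
  have fits: "N j + i * 2 ^ j + 2 ^ j \<le> N (Suc j)" if "i < r" for i j
  proof -
    have "Suc i * 2 ^ j \<le> 2 ^ r * 2 ^ j"
      using that less_exp[of r] by (intro mult_le_mono1) linarith
    then show ?thesis by (simp add: N_def power_add mult.commute)
  qed
  have "AE x in M. \<exists>\<^sub>\<infinity>j. A j x"
  proof (rule conditional_borel_cantelli[where N = N and p = p])
    show "dtm (N (Suc j)) {x\<in>space M. A j x}" for j
    proof (rule determined_Collect[OF determined_space])
      fix x y assume e: "\<And>i. 1 \<le> i \<Longrightarrow> i \<le> N (Suc j) \<Longrightarrow> a i y = a i x" and "A j x"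
      show "A j y"
        unfolding A_def
      proof (intro allI impI)
        fix i assume i: "i < r"
        then obtain k where k: "k \<in> {N j+i*2^j<..N j+i*2^j+2^j}" "t j \<le> a k x"
          using \<open>A j x\<close> unfolding A_def by blast
        then have "a k y = a k x" using fits[OF i, of j] by (intro e) auto
        then show "\<exists>k\<in>{N j+i*2^j<..N j+i*2^j+2^j}. t j \<le> a k y" using k by (intro bexI[of _ k]) auto
      qed
    qed
    show "p j * prob S \<le> prob {x\<in>S. A j x}" if "dtm (N j) S" for j S
      using prob_all_subblocks_ge[OF that t, of "2 ^ j" j r] unfolding p_def A_def by simp
    show "0 \<le> p j" for j using t[of j] by (simp add: p_def)
    show "p j \<le> 1" for j using t[of j] by (auto simp: p_def intro!: power_le_one)
    show "\<not> summable p"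
    proof
      assume sp: "summable p"
      define g where "g j = (2 ^ j / \<phi> (2 ^ j)) ^ r" for j :: nat
      have t_eq: "t j = \<phi> (2 ^ (j + Suc r))" for j
        by (simp add: t_def N_def add.commute)
      \<comment> \<open>Raising the numerator to \<open>2 ^ (j + Suc r)\<close> costs
        \<open>2 ^ (r + 1)\<close>; the two halvings add a factor 4.\<close>
      have g: "(2 ^ j / (2 * t j) / 2) ^ r = g (j + Suc r) / (2 ^ (r + 3)) ^ r" for j
        unfolding g_def power_divide[symmetric] t_eq
        by (rule arg_cong[where f = "\<lambda>x. x ^ r"]) (simp add: power_add)
      \<comment> \<open>If the minimum is 1, then \<open>p j = (1/2) ^ r\<close>. Convergence to 0
        rules this out for large j, where \<open>p\<close> becomes a constant multiple of a shift of
        \<open>g\<close>.\<close>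
      have "eventually (\<lambda>j. p j < (1/2) ^ r) sequentially"
        using summable_LIMSEQ_zero[OF sp] by (rule order_tendstoD) simp
      then have "eventually (\<lambda>j. p j = g (j + Suc r) / (2 ^ (r + 3)) ^ r) sequentially"
      proof eventually_elim
        case (elim j)
        have "\<not> 1 \<le> 2 ^ j / (2 * t j)"
          using elim by (auto simp: p_def min_def)
        then show ?case by (subst g[symmetric]) (simp add: p_def min_def)
      qed
      then have "summable (\<lambda>j. g (j + Suc r) / (2 ^ (r + 3)) ^ r)"
        using sp summable_cong by metis
      then have "summable (\<lambda>j. g (j + Suc r))" by (simp add: summable_divide_iff)
      then have "summable g" by (simp only: summable_iff_shift[of g "Suc r"])
      then show False using div unfolding g_def[abs_def] by contradiction
    qed
  qed (simp add: N_def)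
  then show ?thesis
  proof (rule AE_mp, intro AE_I2 impI)
    fix x assume inf: "\<exists>\<^sub>\<infinity>j. A j x"
    show "\<exists>\<^sub>\<infinity>n. \<exists>k. strict_mono_on {1..r} k \<and>
        (\<forall>i\<in>{1..r}. 1 \<le> k i \<and> k i \<le> n \<and> \<phi> n \<le> a (k i) x)"
      unfolding INFM_nat
    proof
      fix n0
      obtain j where j: "j > n0" "A j x" using inf unfolding INFM_nat by blast
      have "\<forall>i. \<exists>k. i < r \<longrightarrow> N j + i * 2 ^ j < k \<and> k \<le> N j + i * 2 ^ j + 2 ^ j \<and> t j \<le> a k x"
        using j(2) unfolding A_def by (metis greaterThanAtMost_iff)
      then obtain k where k: "\<And>i. i < r \<Longrightarrow> N j + i * 2 ^ j < k i"
          "\<And>i. i < r \<Longrightarrow> k i \<le> N j + i * 2 ^ j + 2 ^ j" "\<And>i. i < r \<Longrightarrow> t j \<le> a (k i) x"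
        by metis
      \<comment> \<open>Sub-blocks are counted from 0, positions in the tuple from 1.\<close>
      let ?k = "\<lambda>i. k (i - 1)"
      have "k i < k i'" if "i < i'" "i' < r" for i i'
      proof -
        have "Suc i * 2 ^ j \<le> i' * 2 ^ j" using that by (intro mult_le_mono1) simp
        then show ?thesis using k(2)[of i] k(1)[of i'] that by simp
      qed
      then have "strict_mono_on {1..r} ?k"
        by (auto intro!: strict_mono_onI)
      moreover have "1 \<le> ?k i \<and> ?k i \<le> N (Suc j) \<and> \<phi> (N (Suc j)) \<le> a (?k i) x"
        if "i \<in> {1..r}" for i
      proof -
        have i: "i - 1 < r" using that by auto
        show ?thesis
          using k(1)[OF i] k(2)[OF i] k(3)[OF i] fits[OF i, of j] unfolding t_def
          by (intro conjI; linarith)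
      qed
      moreover have "n0 < N (Suc j)"
        using j less_exp[of "r + Suc j"] unfolding N_def by linarith
      ultimately show "\<exists>n>n0. \<exists>k. strict_mono_on {1..r} k \<and>
          (\<forall>i\<in>{1..r}. 1 \<le> k i \<and> k i \<le> n \<and> \<phi> n \<le> a (k i) x)"
        by blast
    qed
  qed
qed

end

section \<open>Cylinders of the Gauss map\<close>

text \<open>Dropping the rationals costs a null set and leaves a domain that the Gauss map preserves
  and on which every partial quotient is defined.\<close>

definition irrational_unit :: "real set" where
  "irrational_unit = {0<..<1} - \<rat>"

lemma gauss_map_irrational_unit:
  assumes "y \<in> irrational_unit"
  shows "gauss_map y \<in> irrational_unit" "1 \<le> \<lfloor>1 / y\<rfloor>"
    "y = 1 / (of_int \<lfloor>1 / y\<rfloor> + gauss_map y)"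
proof -
  have y: "0 < y" "y < 1" "y \<notin> \<rat>" using assms by (auto simp: irrational_unit_def)
  have g: "gauss_map y = 1 / y - of_int \<lfloor>1 / y\<rfloor>"
    using y by (simp add: gauss_map_def)
  have notrat: "gauss_map y \<notin> \<rat>"
  proof
    assume "gauss_map y \<in> \<rat>"
    then have "gauss_map y + of_int \<lfloor>1 / y\<rfloor> \<in> \<rat>" by (intro Rats_add) auto
    then have "1 / y \<in> \<rat>" by (simp add: g)
    then have "inverse (1 / y) \<in> \<rat>" by (rule Rats_inverse)
    then show False using y by simp
  qed
  moreover have "gauss_map y \<noteq> 0" using notrat by auto
  moreover have "0 \<le> gauss_map y" "gauss_map y < 1" unfolding g by linarith+
  ultimately show "gauss_map y \<in> irrational_unit"
    by (simp add: irrational_unit_def)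
  show "1 \<le> \<lfloor>1 / y\<rfloor>" using y by (simp add: le_floor_iff)
  show "y = 1 / (of_int \<lfloor>1 / y\<rfloor> + gauss_map y)" using y by (simp add: g)
qed

lemma gauss_map_inverse_branch:
  fixes c :: int
  assumes "y \<in> irrational_unit" "1 \<le> c"
  shows "1 / (of_int c + y) \<in> irrational_unit" "\<lfloor>1 / (1 / (of_int c + y))\<rfloor> = c"
    "gauss_map (1 / (of_int c + y)) = y"
proof -
  have y: "0 < y" "y < 1" "y \<notin> \<rat>" using assms by (auto simp: irrational_unit_def)
  have c: "1 \<le> (of_int c :: real)" using assms(2) by simp
  show fl: "\<lfloor>1 / (1 / (of_int c + y))\<rfloor> = c" using y by (simp add: floor_eq_iff)
  show "gauss_map (1 / (of_int c + y)) = y"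
    using fl y c by (simp add: gauss_map_def)
  have "1 / (of_int c + y) \<notin> \<rat>"
  proof
    assume "1 / (of_int c + y) \<in> \<rat>"
    then have "inverse (1 / (of_int c + y)) - of_int c \<in> \<rat>"
      by (intro Rats_diff Rats_inverse) auto
    then show False using y by simp
  qed
  then show "1 / (of_int c + y) \<in> irrational_unit"
    using y c by (auto simp: irrational_unit_def)
qed

lemma gauss_map_funpow_irrational_unit:
  "x \<in> irrational_unit \<Longrightarrow> (gauss_map ^^ n) x \<in> irrational_unit"
  by (induction n) (auto intro: gauss_map_irrational_unit)

lemma partial_quotient_irrational_unit:
  assumes "x \<in> irrational_unit" "1 \<le> k"
  shows "partial_quotient_defined x k" "1 \<le> partial_quotient x k"
  using gauss_map_funpow_irrational_unit[OF assms(1), of "k - 1"] assms(2)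
    gauss_map_irrational_unit(2)
  by (auto simp: partial_quotient_defined_def partial_quotient_def irrational_unit_def)

text \<open>In terms of the convergents \<open>p\<^sub>k / q\<^sub>k\<close> of the cylinder, \<open>A, B, C, D\<close> are
  \<open>p\<^bsub>n-1\<^esub>, p\<^sub>n, q\<^bsub>n-1\<^esub>, q\<^sub>n\<close>; the inequality \<open>C \<le> D\<close> bounds the distortion by a factor of 2.\<close>

lemma cylinder_moebius:
  fixes b :: "nat \<Rightarrow> int"
  assumes "\<And>i. 1 \<le> i \<Longrightarrow> 1 \<le> b i"
  shows "\<exists>A B C D :: real. \<bar>A * D - B * C\<bar> = 1 \<and> 0 \<le> C \<and> C \<le> D \<and> 0 < D \<and>
    (\<lambda>y. (A * y + B) / (C * y + D)) ` irrational_unit =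
      {x \<in> irrational_unit. \<forall>i\<in>{1..n}. partial_quotient x i = b i} \<and>
    (\<forall>y\<in>irrational_unit. (gauss_map ^^ n) ((A * y + B) / (C * y + D)) = y)"
proof (induction n)
  case 0
  show ?case by (rule exI[of _ 1], rule exI[of _ 0], rule exI[of _ 0], rule exI[of _ 1]) auto
next
  case (Suc n)
  then obtain A B C D :: real where det: "\<bar>A * D - B * C\<bar> = 1" and CD: "0 \<le> C" "C \<le> D" "0 < D"
    and im: "(\<lambda>y. (A * y + B) / (C * y + D)) ` irrational_unit =
      {x \<in> irrational_unit. \<forall>i\<in>{1..n}. partial_quotient x i = b i}"
    and gn: "\<And>y. y \<in> irrational_unit \<Longrightarrow> (gauss_map ^^ n) ((A * y + B) / (C * y + D)) = y"
    by blast
  define f where "f y = (A * y + B) / (C * y + D)" for y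
  define c where "c = b (Suc n)"
  \<comment> \<open>These are the coefficients of \<open>f\<close> composed with the inverse branch
    sending y to \<open>1 / (c + y)\<close>, as in the recurrence for convergents.\<close>
  define f' where "f' y = (B * y + (A + of_int c * B)) / (D * y + (C + of_int c * D))" for y
  have c: "1 \<le> c" by (simp add: c_def assms)
  then have c': "1 \<le> (of_int c :: real)" by simp
  have f': "f' y = f (1 / (of_int c + y))" if "y \<in> irrational_unit" for y
  proof -
    have y: "0 < y" using that by (simp add: irrational_unit_def)
    define p where "p = of_int c + y"
    have p: "0 < p" using y c' by (simp add: p_def)
    have "f (1 / p) = (A * (1 / p) + B) * p / ((C * (1 / p) + D) * p)"
      unfolding f_def using p by simp
    also have "(A * (1 / p) + B) * p = A + B * p"
      using p by (simp add: distrib_right)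
    also have "(C * (1 / p) + D) * p = C + D * p"
      using p by (simp add: distrib_right)
    also have "(A + B * p) / (C + D * p) = f' y"
      by (simp add: f'_def p_def algebra_simps)
    finally show ?thesis by (simp add: p_def)
  qed
  have cyl: "{x \<in> irrational_unit. \<forall>i\<in>{1..Suc n}. partial_quotient x i = b i} =
      {x \<in> f ` irrational_unit. \<lfloor>1 / (gauss_map ^^ n) x\<rfloor> = c}"
    unfolding f_def im by (auto simp: atLeastAtMostSuc_conv partial_quotient_def c_def)
  have "f' ` irrational_unit = {x \<in> irrational_unit. \<forall>i\<in>{1..Suc n}. partial_quotient x i = b i}"
    unfolding cyl
  proof (intro equalityI subsetI)
    fix x assume "x \<in> f' ` irrational_unit"
    then obtain y where y: "y \<in> irrational_unit" "x = f' y" by blast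
    let ?z = "1 / (of_int c + y)"
    have z: "?z \<in> irrational_unit" "\<lfloor>1 / ?z\<rfloor> = c"
      using gauss_map_inverse_branch[OF y(1) c] by auto
    have "x = f ?z" using y f' by simp
    moreover have "(gauss_map ^^ n) (f ?z) = ?z" using gn[OF z(1)] by (simp add: f_def)
    ultimately show "x \<in> {x \<in> f ` irrational_unit. \<lfloor>1 / (gauss_map ^^ n) x\<rfloor> = c}"
      using z by simp
  next
    fix x assume "x \<in> {x \<in> f ` irrational_unit. \<lfloor>1 / (gauss_map ^^ n) x\<rfloor> = c}"
    then obtain z where z: "z \<in> irrational_unit" "x = f z" "\<lfloor>1 / (gauss_map ^^ n) (f z)\<rfloor> = c"
      by blast
    then have "\<lfloor>1 / z\<rfloor> = c" using gn[OF z(1)] by (simp add: f_def)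
    then have "z = 1 / (of_int c + gauss_map z)"
      using gauss_map_irrational_unit(3)[OF z(1)] by simp
    then have "x = f' (gauss_map z)"
      using f'[OF gauss_map_irrational_unit(1)[OF z(1)]] z(2) by simp
    then show "x \<in> f' ` irrational_unit"
      using gauss_map_irrational_unit(1)[OF z(1)] by blast
  qed
  moreover have "(gauss_map ^^ Suc n) (f' y) = y" if "y \<in> irrational_unit" for y
    using gn[OF gauss_map_inverse_branch(1)[OF that c]] gauss_map_inverse_branch(3)[OF that c]
    by (simp add: f'[OF that] f_def)
  \<comment> \<open>The determinant changes sign with each digit, so only its absolute value is
    tracked.\<close>
  moreover have "\<bar>B * (C + of_int c * D) - (A + of_int c * B) * D\<bar> = 1"
  proof -
    have "B * (C + of_int c * D) - (A + of_int c * B) * D = - (A * D - B * C)"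
      by (simp add: algebra_simps)
    then show ?thesis using det by linarith
  qed
  moreover have "0 < C + of_int c * D" "D \<le> C + of_int c * D"
    using CD c' mult_right_mono[OF c', of D] by linarith+
  ultimately show ?case
    using CD(3) unfolding f'_def by (intro exI[of _ B] exI[of _ "A + of_int c * B"] exI[of _ D]
        exI[of _ "C + of_int c * D"]) simp
qed

text \<open>The distance from \<open>f 0\<close> to \<open>f y\<close> is \<open>h y\<close>, which
  increases strictly from 0. Hence the image of an interval from 0 to \<open>u\<close> is an
  interval of length \<open>h u\<close>, and the images of rationals form a countable set.\<close>

lemma moebius_image_measure:
  fixes A B C D u :: real
  assumes det: "\<bar>A * D - B * C\<bar> = 1" and C: "0 \<le> C" and D: "0 < D" and u: "0 \<le> u"
  defines "f \<equiv> \<lambda>y. (A * y + B) / (C * y + D)"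
  shows "f ` ({0<..<u} - \<rat>) \<in> sets lebesgue"
    "emeasure lebesgue (f ` ({0<..<u} - \<rat>)) = ennreal (u / (D * (C * u + D)))"
proof -
  define h where "h y = y / (D * (C * y + D))" for y
  have pos: "0 < C * y + D" if "0 \<le> y" for y
    using C D that by (intro add_nonneg_pos mult_nonneg_nonneg)
  have h_less: "h y < h z \<longleftrightarrow> y < z" if "0 \<le> y" "0 \<le> z" for y z
  proof -
    have "h y < h z \<longleftrightarrow> y * (C * z + D) < z * (C * y + D)"
      using pos[OF that(1)] pos[OF that(2)] D unfolding h_def
      by (simp add: divide_less_eq less_divide_eq mult.commute mult.left_commute)
    also have "\<dots> \<longleftrightarrow> y * D < z * D" by (simp add: algebra_simps)
    also have "\<dots> \<longleftrightarrow> y < z" using D by simp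
    finally show ?thesis .
  qed
  have h_im: "h ` {0<..<u} = {0<..<h u}"
  proof (intro equalityI subsetI)
    fix z assume "z \<in> h ` {0<..<u}"
    then show "z \<in> {0<..<h u}"
      using h_less[of 0] h_less[of _ u] u by (auto simp: h_def[of 0])
  next
    fix z assume z: "z \<in> {0<..<h u}"
    have "continuous_on {0..u} h"
      unfolding h_def using pos D by (intro continuous_intros) (auto simp: less_imp_neq[symmetric])
    then obtain y where y: "0 \<le> y" "y \<le> u" "h y = z"
      using IVT'[of h 0 z u] z u by (auto simp: h_def[of 0])
    then have "y \<noteq> 0" "y \<noteq> u" using z by (auto simp: h_def[of 0])
    then show "z \<in> h ` {0<..<u}" using y by force
  qed
  have f: "f y = B / D + (A * D - B * C) * h y" if "0 \<le> y" for y
  proof -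
    have "B * (C * y + D) + (A * D - B * C) * y = (A * y + B) * D"
      by (simp add: algebra_simps)
    then have "f y = (B * (C * y + D) + (A * D - B * C) * y) / (D * (C * y + D))"
      using D by (simp add: f_def)
    also have "\<dots> = B * (C * y + D) / (D * (C * y + D)) + (A * D - B * C) * h y"
      by (simp add: add_divide_distrib h_def)
    also have "B * (C * y + D) / (D * (C * y + D)) = B / D"
      using pos[OF that] by simp
    finally show ?thesis .
  qed
  have hu: "0 \<le> h u" using pos[OF u] D u by (simp add: h_def)
  have "\<exists>l. f ` {0<..<u} = {l<..<l + h u}"
  proof (cases "A * D - B * C = 1")
    case True
    have "f ` {0<..<u} = (+) (B / D) ` h ` {0<..<u}"
      unfolding image_image using f True by (intro image_cong) auto
    also have "\<dots> = {B / D<..<B / D + h u}"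
      unfolding h_im by (auto intro!: image_eqI[of _ _ "z - B / D" for z])
    finally show ?thesis by blast
  next
    case False
    then have "A * D - B * C = - 1" using det by linarith
    then have "f ` {0<..<u} = (-) (B / D) ` h ` {0<..<u}"
      unfolding image_image using f by (intro image_cong) auto
    also have "\<dots> = {B / D - h u<..<B / D - h u + h u}"
      unfolding h_im by (auto intro!: image_eqI[of _ _ "B / D - z" for z])
    finally show ?thesis by blast
  qed
  then obtain l where l: "f ` {0<..<u} = {l<..<l + h u}" by blast
  have inj: "inj_on f {0<..<u}"
  proof (rule inj_onI)
    fix y z assume yz: "y \<in> {0<..<u}" "z \<in> {0<..<u}" "f y = f z"
    have "A * D - B * C \<noteq> 0" using det by auto
    then have "h y = h z" using yz f by simp
    then show "y = z" using h_less[of y z] h_less[of z y] yz by auto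
  qed
  define R where "R = f ` ({0<..<u} \<inter> \<rat>)"
  have diff: "f ` ({0<..<u} - \<rat>) = {l<..<l + h u} - R"
  proof -
    have "f ` ({0<..<u} - ({0<..<u} \<inter> \<rat>)) = f ` {0<..<u} - R"
      unfolding R_def by (rule inj_on_image_set_diff[OF inj]) auto
    then show ?thesis unfolding l by (simp add: Diff_Int_distrib Diff_Int)
  qed
  have "countable R"
    unfolding R_def using countable_rat by (intro countable_image countable_Int2)
  then have "R \<in> null_sets lborel" by (rule countable_imp_null_set_lborel)
  then have R: "R \<in> null_sets lebesgue" by (rule null_sets_completionI)
  then show "f ` ({0<..<u} - \<rat>) \<in> sets lebesgue"
    unfolding diff by auto
  have "emeasure lebesgue (f ` ({0<..<u} - \<rat>)) = emeasure lebesgue {l<..<l + h u}"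
    unfolding diff using R by (intro emeasure_Diff_null_set) auto
  also have "\<dots> = ennreal (h u)" using hu by simp
  finally show "emeasure lebesgue (f ` ({0<..<u} - \<rat>)) = ennreal (u / (D * (C * u + D)))"
    by (simp add: h_def)
qed

lemma sets_irrational_unit: "irrational_unit \<in> sets lebesgue"
  and emeasure_irrational_unit: "emeasure lebesgue irrational_unit = 1"
  \<comment> \<open>The identity map; the values are those of \<open>A\<close>, \<open>D\<close>,
    \<open>B\<close>, \<open>C\<close>, \<open>u\<close> in this order.\<close>
  using moebius_image_measure[of 1 1 0 0 1] by (simp_all add: irrational_unit_def)

section \<open>Digit tails under Lebesgue measure on the irrationals\<close>

abbreviation irr_lebesgue :: "real measure" where
  "irr_lebesgue \<equiv> lebesgue_on irrational_unit"

lemma space_irr_lebesgue: "space irr_lebesgue = irrational_unit"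
  by (simp add: space_restrict_space)

lemma prob_space_irr_lebesgue: "prob_space irr_lebesgue"
  by (rule prob_spaceI)
    (simp add: emeasure_restrict_space sets_irrational_unit emeasure_irrational_unit)

lemma irr_lebesgue_subset:
  assumes "X \<subseteq> irrational_unit" "X \<in> sets lebesgue" "emeasure lebesgue X = ennreal v" "0 \<le> v"
  shows "X \<in> sets irr_lebesgue" "measure irr_lebesgue X = v"
proof -
  show "X \<in> sets irr_lebesgue"
    using assms by (simp add: sets_restrict_space_iff sets_irrational_unit)
  show "measure irr_lebesgue X = v"
    using assms by (simp add: measure_def emeasure_restrict_space sets_irrational_unit)
qed

text \<open>Digits are integers at least 1, so the threshold may be rounded up; irrationality of
  \<open>y\<close> makes the last inequality strict, which fits the open intervals of
  \<open>moebius_image_measure\<close>.\<close>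

lemma le_floor_inverse_iff:
  fixes t y :: real
  assumes "y \<in> irrational_unit"
  shows "t \<le> of_int \<lfloor>1 / y\<rfloor> \<longleftrightarrow> y < 1 / of_int (max 1 \<lceil>t\<rceil>)"
proof -
  let ?m = "max 1 \<lceil>t\<rceil>"
  have y: "0 < y" "y < 1" "y \<notin> \<rat>" using assms by (auto simp: irrational_unit_def)
  have m: "(0::real) < of_int ?m" by (simp add: max_def)
  have "1 \<le> \<lfloor>1 / y\<rfloor>" using y by (simp add: le_floor_iff)
  then have "t \<le> of_int \<lfloor>1 / y\<rfloor> \<longleftrightarrow> ?m \<le> \<lfloor>1 / y\<rfloor>" by (simp add: ceiling_le_iff)
  also have "\<dots> \<longleftrightarrow> of_int ?m \<le> 1 / y" by (simp only: le_floor_iff)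
  also have "\<dots> \<longleftrightarrow> y \<le> 1 / of_int ?m"
    using y m by (simp only: le_divide_eq mult.commute) simp
  also have "\<dots> \<longleftrightarrow> y < 1 / of_int ?m"
  proof -
    have "1 / of_int ?m \<in> (\<rat> :: real set)" by (intro Rats_divide) auto
    then have "y \<noteq> 1 / of_int ?m" using y by blast
    then show ?thesis by linarith
  qed
  finally show ?thesis .
qed

text \<open>\<open>X\<close> and \<open>Y\<close> are images of the irrationals in
  \<open>(0, 1)\<close> and \<open>(0, u)\<close> under one Moebius map, \<open>1 / u\<close> being
  the rounded threshold. The ratio of their lengths is \<open>u * (C + D) / (C * u + D)\<close>,
  between \<open>u\<close> and \<open>2 * u\<close> because \<open>0 <= C <= D\<close> and
  \<open>u <= 1\<close>.\<close>

lemma cylinder_tail_measure: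
  fixes x0 t :: real and n :: nat
  assumes x0: "x0 \<in> irrational_unit" and t: "t > 0"
  defines "X \<equiv> {x \<in> irrational_unit. \<forall>i\<in>{1..n}. partial_quotient x i = partial_quotient x0 i}"
  defines "Y \<equiv> {x \<in> X. t \<le> real_of_int (partial_quotient x (Suc n))}"
  shows "X \<in> sets irr_lebesgue" "Y \<in> sets irr_lebesgue"
    "min 1 (1 / (2 * t)) * measure irr_lebesgue X \<le> measure irr_lebesgue Y"
    "measure irr_lebesgue Y \<le> 2 / t * measure irr_lebesgue X"
proof -
  obtain A B C D :: real where det: "\<bar>A * D - B * C\<bar> = 1" and CD: "0 \<le> C" "C \<le> D" "0 < D"
    and im: "(\<lambda>y. (A * y + B) / (C * y + D)) ` irrational_unit = X"
    and gn: "\<And>y. y \<in> irrational_unit \<Longrightarrow> (gauss_map ^^ n) ((A * y + B) / (C * y + D)) = y"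
    using cylinder_moebius[of "partial_quotient x0" n] partial_quotient_irrational_unit(2)[OF x0]
    unfolding X_def by blast
  define u where "u = 1 / real_of_int (max 1 \<lceil>t\<rceil>)"
  have m: "1 \<le> real_of_int (max 1 \<lceil>t\<rceil>)" by simp
  have u: "0 < u" "u \<le> 1" using m by (auto simp: u_def)
  have "(\<lambda>y. (A * y + B) / (C * y + D)) ` ({0<..<u} - \<rat>) =
      (\<lambda>y. (A * y + B) / (C * y + D)) ` {y \<in> irrational_unit. y < u}"
    using u by (intro arg_cong2[where f = image] refl) (auto simp: irrational_unit_def)
  also have "\<dots> = Y"
    unfolding Y_def im[symmetric] partial_quotient_def u_def
    using le_floor_inverse_iff[where t = t] gn by auto
  finally have imY: "(\<lambda>y. (A * y + B) / (C * y + D)) ` ({0<..<u} - \<rat>) = Y" .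
  have imX: "(\<lambda>y. (A * y + B) / (C * y + D)) ` ({0<..<1} - \<rat>) = X"
    using im by (simp add: irrational_unit_def)
  have Xsub: "X \<subseteq> irrational_unit" unfolding X_def by blast
  have Ysub: "Y \<subseteq> irrational_unit" unfolding Y_def using Xsub by blast
  define h where "h v = v / (D * (C * v + D))" for v
  have h0: "0 \<le> h v" if "0 \<le> v" for v
    using CD that by (auto simp: h_def)
  note eX = moebius_image_measure[OF det CD(1,3), of 1, unfolded imX h_def[symmetric], simplified]
  note eY = moebius_image_measure[OF det CD(1,3), of u, unfolded imY h_def[symmetric]]
  show "X \<in> sets irr_lebesgue"
    using irr_lebesgue_subset[OF Xsub eX h0] by simp
  show "Y \<in> sets irr_lebesgue"
    using irr_lebesgue_subset[OF Ysub eY h0] u by simp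
  have X: "measure irr_lebesgue X = h 1"
    using irr_lebesgue_subset[OF Xsub eX h0] by simp
  have Y: "measure irr_lebesgue Y = h u"
    using irr_lebesgue_subset[OF Ysub eY h0] u by simp
  have den: "0 < C * u + D" "0 < C + D" "C * u \<le> C" "0 \<le> C * u"
    using CD u by (auto intro: add_nonneg_pos mult_left_le)
  have lo: "u * h 1 \<le> h u"
  proof -
    have "u * h 1 = u / (D * (C + D))" by (simp add: h_def)
    also have "\<dots> \<le> u / (D * (C * u + D))"
      by (intro divide_left_mono mult_left_mono mult_pos_pos den(1,2) CD(3)) (use den CD u in linarith)+
    finally show ?thesis by (simp add: h_def)
  qed
  have hi: "h u \<le> 2 * u * h 1"
  proof -
    have le: "C + D \<le> 2 * (C * u + D)" using den(4) CD(2) by (simp add: distrib_left)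
    have "u / (D * e) = 2 * u / (D * (2 * e))" for e by simp
    then have "h u = 2 * u / (D * (2 * (C * u + D)))" unfolding h_def .
    also have "\<dots> \<le> 2 * u / (D * (C + D))"
      by (intro divide_left_mono mult_left_mono[OF le] mult_pos_pos den(1,2) CD(3) zero_less_numeral)
        (use CD u in simp_all)
    finally show ?thesis by (simp add: h_def)
  qed
  \<comment> \<open>Rounding up at most doubles a threshold \<open>t > 1\<close>; for
    \<open>t <= 1\<close> it gives \<open>u = 1\<close>.\<close>
  have u_ge: "min 1 (1 / (2 * t)) \<le> u"
  proof (cases "t \<le> 1")
    case True
    then have "\<lceil>t\<rceil> \<le> 1" by (simp add: ceiling_le_iff)
    then have "max 1 \<lceil>t\<rceil> = 1" by (rule max_absorb1)
    then show ?thesis by (simp add: u_def)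
  next
    case False
    then have "real_of_int (max 1 \<lceil>t\<rceil>) \<le> 2 * t"
      using ceiling_correct[of t] by (simp add: max_def)
    then have "1 / (2 * t) \<le> u" unfolding u_def using t m by (intro divide_left_mono) auto
    then show ?thesis by linarith
  qed
  have u_le: "u \<le> 1 / t"
  proof -
    have "t \<le> real_of_int (max 1 \<lceil>t\<rceil>)"
      by (metis le_of_int_ceiling max.cobounded2 of_int_le_iff order_trans)
    then show ?thesis unfolding u_def using t by (intro divide_left_mono mult_pos_pos) auto
  qed
  show "min 1 (1 / (2 * t)) * measure irr_lebesgue X \<le> measure irr_lebesgue Y"
    unfolding X Y using mult_right_mono[OF u_ge h0[of 1]] lo by simp
  show "measure irr_lebesgue Y \<le> 2 / t * measure irr_lebesgue X"
    unfolding X Y using mult_right_mono[OF u_le h0[of 1]] hi by simp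
qed

text \<open>Carries bounds from cylinders to countable unions of them; exchanging \<open>X\<close>
  and \<open>Y\<close> serves the other tail bound. Extended reals avoid summability
  conditions.\<close>

lemma (in finite_measure) measure_UN_le_mult:
  fixes X Y :: "'i \<Rightarrow> 'a set"
  assumes I: "countable I" and X: "\<And>i. i \<in> I \<Longrightarrow> X i \<in> sets M" "disjoint_family_on X I"
    and Y: "\<And>i. i \<in> I \<Longrightarrow> Y i \<in> sets M" "disjoint_family_on Y I"
    and le: "\<And>i. i \<in> I \<Longrightarrow> measure M (Y i) \<le> c * measure M (X i)" and c: "0 \<le> c"
  shows "measure M (\<Union>i\<in>I. Y i) \<le> c * measure M (\<Union>i\<in>I. X i)"
proof -
  have "emeasure M (\<Union>i\<in>I. Y i) = (\<integral>\<^sup>+i. emeasure M (Y i) \<partial>count_space I)"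
    using I Y by (intro emeasure_UN_countable) auto
  also have "\<dots> \<le> (\<integral>\<^sup>+i. ennreal c * emeasure M (X i) \<partial>count_space I)"
    using le c by (intro nn_integral_mono)
      (simp add: emeasure_eq_measure ennreal_mult[symmetric] ennreal_leI)
  also have "\<dots> = ennreal c * (\<integral>\<^sup>+i. emeasure M (X i) \<partial>count_space I)"
    by (rule nn_integral_cmult) simp
  also have "(\<integral>\<^sup>+i. emeasure M (X i) \<partial>count_space I) = emeasure M (\<Union>i\<in>I. X i)"
    using I X by (intro emeasure_UN_countable[symmetric]) auto
  finally show ?thesis
    using c by (simp add: emeasure_eq_measure ennreal_mult[symmetric])
qed

lemma digit_process_gauss:
  "digit_process irr_lebesgue (\<lambda>i x. real_of_int (partial_quotient x i))"
proof -
  interpret prob_space irr_lebesgue by (rule prob_space_irr_lebesgue)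
  define a where "a i x = real_of_int (partial_quotient x i)" for i x
  \<comment> \<open>Lists of integers label the cylinders and are countable in number, so every
    determined set is a countable disjoint union of cylinders.\<close>
  define w where "w n x = map (partial_quotient x) [1..<Suc n]" for n x
  define X where "X n l = {x \<in> irrational_unit. w n x = l}" for n l
  define Y where "Y n t l = {x \<in> X n l. t \<le> a (Suc n) x}" for n t l
  have w: "w n y = w n x \<longleftrightarrow> (\<forall>i\<in>{1..n}. partial_quotient y i = partial_quotient x i)" for n x y
    by (auto simp: w_def)
  have decomp: "S = (\<Union>l\<in>w n ` S. X n l)" and sub: "S \<subseteq> irrational_unit"
    if "determined irrational_unit a n S" for n S
  proof -
    show "S \<subseteq> irrational_unit" using that by (simp add: determined_def)
    show "S = (\<Union>l\<in>w n ` S. X n l)"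
    proof (intro equalityI subsetI)
      fix y assume "y \<in> (\<Union>l\<in>w n ` S. X n l)"
      then obtain x where "x \<in> S" "y \<in> irrational_unit" "w n y = w n x"
        unfolding X_def by auto
      then show "y \<in> S" using that w unfolding determined_def a_def by auto
    qed (use that in \<open>auto simp: X_def determined_def\<close>)
  qed
  have decompY: "{x\<in>S. t \<le> a (Suc n) x} = (\<Union>l\<in>w n ` S. Y n t l)"
    if "determined irrational_unit a n S" for n S t
    using decomp[OF that] unfolding Y_def by blast
  have cyl: "X n l \<in> sets irr_lebesgue \<and> Y n t l \<in> sets irr_lebesgue \<and>
      min 1 (1 / (2 * t)) * prob (X n l) \<le> prob (Y n t l) \<and> prob (Y n t l) \<le> 2 / t * prob (X n l)"
    if S: "determined irrational_unit a n S" and l: "l \<in> w n ` S" and t: "t > 0" for n S l t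
  proof -
    obtain x0 where x0: "x0 \<in> irrational_unit" "l = w n x0" using l sub[OF S] by blast
    have "X n l = {x \<in> irrational_unit. \<forall>i\<in>{1..n}. partial_quotient x i = partial_quotient x0 i}"
      unfolding X_def x0(2) w ..
    then show ?thesis
      using cylinder_tail_measure[OF x0(1) t, of n] unfolding Y_def a_def by simp
  qed
  have dX: "disjoint_family_on (X n) I" and dY: "disjoint_family_on (Y n t) I" for n t I
    by (auto simp: disjoint_family_on_def X_def Y_def)
  have cnt: "countable (w n ` S)" for n S by simp
  show ?thesis
    unfolding a_def[symmetric]
  proof (intro digit_process.intro digit_process_axioms.intro prob_space_irr_lebesgue)
    fix n S assume "determined (space irr_lebesgue) a n S"
    then have S: "determined irrational_unit a n S" by (simp add: space_irr_lebesgue)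
    have "(\<Union>l\<in>w n ` S. X n l) \<in> events"
      by (intro sets.countable_UN'[OF cnt]) (use cyl[OF S _ zero_less_one] in blast)
    then show "S \<in> events" using decomp[OF S] by simp
  next
    fix n S and t :: real assume "determined (space irr_lebesgue) a n S" and t: "t > 0"
    then have S: "determined irrational_unit a n S" by (simp add: space_irr_lebesgue)
    let ?q = "min 1 (1 / (2 * t))"
    have "0 < ?q" using t by simp
    \<comment> \<open>Division by \<open>?q\<close> puts the lower bound into the form of
      \<open>measure_UN_le_mult\<close>.\<close>
    then have le_iff: "?q * v \<le> v' \<longleftrightarrow> v \<le> 1 / ?q * v'" for v v'
      by (simp add: pos_le_divide_eq mult.commute)
    have "prob (\<Union>l\<in>w n ` S. X n l) \<le> (1 / ?q) * prob (\<Union>l\<in>w n ` S. Y n t l)"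
    proof (rule measure_UN_le_mult[OF cnt _ dY _ dX])
      fix l assume l: "l \<in> w n ` S"
      show "prob (X n l) \<le> 1 / ?q * prob (Y n t l)"
        unfolding le_iff[symmetric] using cyl[OF S l t] by blast
    qed (use cyl[OF S _ t] t in auto)
    then show "?q * prob S \<le> prob {x\<in>S. t \<le> a (Suc n) x}"
      unfolding decompY[OF S] decomp[OF S, symmetric] le_iff .
    have "prob (\<Union>l\<in>w n ` S. Y n t l) \<le> 2 / t * prob (\<Union>l\<in>w n ` S. X n l)"
      by (rule measure_UN_le_mult[OF cnt _ dX _ dY]) (use cyl[OF S _ t] t in auto)
    then show "prob {x\<in>S. t \<le> a (Suc n) x} \<le> 2 / t * prob S"
      unfolding decompY[OF S] decomp[OF S, symmetric] .
  qed
qed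

section \<open>The zero-one law\<close>

lemma tail_min:
  assumes "has_tail_min \<psi> n"
  shows "\<exists>m\<ge>n. tail_min \<psi> n = \<psi> m" "\<And>j. n \<le> j \<Longrightarrow> tail_min \<psi> n \<le> \<psi> j"
proof -
  obtain m where m: "n \<le> m" "\<And>j. n \<le> j \<Longrightarrow> \<psi> m \<le> \<psi> j"
    using assms unfolding has_tail_min_def by blast
  have "tail_min \<psi> n = \<psi> m"
    unfolding tail_min_def using m by (intro Least_equality) auto
  then show "\<exists>m\<ge>n. tail_min \<psi> n = \<psi> m" "\<And>j. n \<le> j \<Longrightarrow> tail_min \<psi> n \<le> \<psi> j"
    using m by auto
qed

text \<open>The rationals are put into the exceptional set, so that points of \<open>[0, 1)\<close>
  outside it are automatically irrational.\<close>

lemma AE_irr_lebesgueE: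
  assumes "AE x in irr_lebesgue. P x"
  obtains N where "negligible N" "\<And>x. 0 \<le> x \<Longrightarrow> x < 1 \<Longrightarrow> x \<notin> N \<Longrightarrow> x \<in> irrational_unit \<and> P x"
proof -
  have "AE x in lebesgue. x \<in> irrational_unit \<longrightarrow> P x"
    using assms sets_irrational_unit by (simp add: AE_restrict_space_iff)
  then obtain N where N: "negligible N" "{x. \<not> (x \<in> irrational_unit \<longrightarrow> P x)} \<subseteq> N"
    unfolding eventually_ae_filter_negligible by blast
  have "negligible (N \<union> \<rat>)"
    using N countable_rat
    by (auto simp: negligible_iff_null_sets intro: null_sets_completionI countable_imp_null_set_lborel)
  moreover have "x \<in> irrational_unit \<and> P x" if "0 \<le> x" "x < 1" "x \<notin> N \<union> \<rat>" for x
  proof -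
    have "x \<noteq> 0" using that Rats_0 by blast
    then have "x \<in> irrational_unit" using that by (simp add: irrational_unit_def)
    then show ?thesis using N(2) that by blast
  qed
  ultimately show thesis by (rule that)
qed

theorem theorem1p7:
  fixes r :: nat and \<psi> :: "nat \<Rightarrow> real"
  assumes "r \<ge> 1"
    and "\<And>n. n \<ge> 1 \<Longrightarrow> \<psi> n > 0"
    and "\<And>n. n \<ge> 1 \<Longrightarrow> has_tail_min \<psi> n"
  shows "F_set r \<psi> \<in> sets (lebesgue_on {0..<1}) \<and>
    (summable (\<lambda>n. real (Suc n) ^ (r - 1) * tail_min \<psi> (Suc n) powi (- int r)) \<longrightarrow>
       emeasure (lebesgue_on {0..<1}) (F_set r \<psi>) = 0) \<and>
    (\<not> summable (\<lambda>n. real (Suc n) ^ (r - 1) * tail_min \<psi> (Suc n) powi (- int r)) \<longrightarrow>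
       emeasure (lebesgue_on {0..<1}) (F_set r \<psi>) = 1)"
proof -
  interpret digit_process irr_lebesgue "\<lambda>i x. real_of_int (partial_quotient x i)"
    by (rule digit_process_gauss)
  define \<phi> where "\<phi> = tail_min \<psi>"
  have attained: "\<exists>m\<ge>n. \<phi> n = \<psi> m" if "1 \<le> n" for n
    unfolding \<phi>_def using tail_min assms(3) that by blast
  have \<phi>_le: "\<phi> n \<le> \<psi> j" if "1 \<le> n" "n \<le> j" for n j
    unfolding \<phi>_def using tail_min assms(3) that by blast
  have pos: "\<phi> n > 0" if "1 \<le> n" for n
    using attained[OF that] assms(2) that by force
  have mono: "\<phi> m \<le> \<phi> n" if "1 \<le> m" "m \<le> n" for m n
    using attained[of n] \<phi>_le[of m] that by force
  have sum_iff: "summable (\<lambda>n. real (Suc n) ^ (r - 1) * tail_min \<psi> (Suc n) powi (- int r)) \<longleftrightarrow>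
      summable (\<lambda>j. (2 ^ j / \<phi> (2 ^ j)) ^ r)"
    using summable_power_condensation_iff[of r \<phi>, OF assms(1) pos mono] unfolding \<phi>_def .
  have "emeasure (lebesgue_on {0..<1::real}) X = emeasure lebesgue X" if "X \<subseteq> {0..<1}" for X
    using that by (intro emeasure_restrict_space) auto
  moreover have F_sub: "F_set r \<psi> \<subseteq> {0..<1}" by (auto simp: F_set_def)
  ultimately have em: "emeasure (lebesgue_on {0..<1}) (F_set r \<psi>) = emeasure lebesgue (F_set r \<psi>)"
    by blast
  have sets: "F_set r \<psi> \<in> sets (lebesgue_on {0..<1}) \<longleftrightarrow> F_set r \<psi> \<in> sets lebesgue"
    using F_sub by (simp add: sets_restrict_space_iff)
  show ?thesis
  proof (cases "summable (\<lambda>j. (2 ^ j / \<phi> (2 ^ j)) ^ r)")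
    case True
    obtain N where N: "negligible N" "\<And>x. 0 \<le> x \<Longrightarrow> x < 1 \<Longrightarrow> x \<notin> N \<Longrightarrow> x \<in> irrational_unit \<and>
        \<not> (\<exists>\<^sub>\<infinity>n. \<exists>K\<subseteq>{1..n}. card K = r \<and> (\<forall>k\<in>K. \<phi> n \<le> real_of_int (partial_quotient x k)))"
      using AE_irr_lebesgueE[OF AE_finitely_often[OF pos mono True]] by blast
    \<comment> \<open>The same \<open>n\<close> serves for \<open>\<phi>\<close> because
      \<open>\<phi> n \<le> \<psi> n\<close>. By completeness of Lebesgue measure the inclusion also
      gives measurability.\<close>
    have "F_set r \<psi> \<subseteq> N"
    proof
      fix x assume x: "x \<in> F_set r \<psi>"
      let ?Q = "\<lambda>n. 1 \<le> n \<and> (\<exists>k :: nat \<Rightarrow> nat. strict_mono_on {1..r} k \<and>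
        (\<forall>i\<in>{1..r}. 1 \<le> k i \<and> k i \<le> n \<and> partial_quotient_defined x (k i) \<and>
           real_of_int (partial_quotient x (k i)) \<ge> \<psi> n))"
      have "\<exists>\<^sub>\<infinity>n. ?Q n" using x by (simp add: F_set_def frequently_cofinite)
      then have "\<exists>\<^sub>\<infinity>n. \<exists>K\<subseteq>{1..n}. card K = r \<and> (\<forall>k\<in>K. \<phi> n \<le> real_of_int (partial_quotient x k))"
      proof (rule frequently_elim1)
        fix n assume "?Q n"
        then obtain k where n: "1 \<le> n" and k: "strict_mono_on {1..r} k"
          "\<And>i. i \<in> {1..r} \<Longrightarrow> 1 \<le> k i \<and> k i \<le> n \<and> real_of_int (partial_quotient x (k i)) \<ge> \<psi> n"
          by blast
        have "card (k ` {1..r}) = r"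
          using k(1) by (simp add: card_image strict_mono_on_imp_inj_on)
        moreover have "k ` {1..r} \<subseteq> {1..n}"
          using k(2) by auto
        moreover have "\<forall>j\<in>k ` {1..r}. \<phi> n \<le> real_of_int (partial_quotient x j)"
          using k(2) \<phi>_le[OF n order_refl] by force
        ultimately show "\<exists>K\<subseteq>{1..n}. card K = r \<and> (\<forall>k\<in>K. \<phi> n \<le> real_of_int (partial_quotient x k))"
          by blast
      qed
      moreover have "0 \<le> x" "x < 1" using x F_sub by auto
      ultimately show "x \<in> N" using N(2)[of x] by blast
    qed
    then have "F_set r \<psi> \<in> null_sets lebesgue"
      using N(1) negligible_subset negligible_iff_null_sets by blast
    then show ?thesis using True unfolding sum_iff em sets by auto
  next
    case False
    obtain N where N: "negligible N" "\<And>x. 0 \<le> x \<Longrightarrow> x < 1 \<Longrightarrow> x \<notin> N \<Longrightarrow> x \<in> irrational_unit \<and>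
        (\<exists>\<^sub>\<infinity>n. \<exists>k. strict_mono_on {1..r} k \<and> (\<forall>i\<in>{1..r}. 1 \<le> k i \<and> k i \<le> n \<and>
          \<phi> n \<le> real_of_int (partial_quotient x (k i))))"
      using AE_irr_lebesgueE[OF AE_infinitely_often[OF pos False]] by blast
    have "{0..<1} - F_set r \<psi> \<subseteq> N"
    proof
      fix x assume x: "x \<in> {0..<1} - F_set r \<psi>"
      let ?Q = "\<lambda>n. 1 \<le> n \<and> (\<exists>k :: nat \<Rightarrow> nat. strict_mono_on {1..r} k \<and>
        (\<forall>i\<in>{1..r}. 1 \<le> k i \<and> k i \<le> n \<and> partial_quotient_defined x (k i) \<and>
           real_of_int (partial_quotient x (k i)) \<ge> \<psi> n))"
      show "x \<in> N"
      proof (rule ccontr)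
        assume "x \<notin> N"
        then have irr: "x \<in> irrational_unit" and inf: "\<exists>\<^sub>\<infinity>n. \<exists>k. strict_mono_on {1..r} k \<and>
            (\<forall>i\<in>{1..r}. 1 \<le> k i \<and> k i \<le> n \<and> \<phi> n \<le> real_of_int (partial_quotient x (k i)))"
          using N(2)[of x] x by auto
        have "\<exists>\<^sub>\<infinity>n. ?Q n"
          unfolding INFM_nat
        proof
          fix n0
          obtain n k where n: "n > n0" and k: "strict_mono_on {1..r} k"
            "\<And>i. i \<in> {1..r} \<Longrightarrow> 1 \<le> k i \<and> k i \<le> n \<and> \<phi> n \<le> real_of_int (partial_quotient x (k i))"
            using inf unfolding INFM_nat by blast
          \<comment> \<open>Passing from \<open>n\<close> to an \<open>m\<close> where the tail
            minimum is attained keeps the threshold, and \<open>k i <= n <= m\<close> keeps the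
            indices admissible.\<close>
          obtain m where m: "n \<le> m" "\<phi> n = \<psi> m" using attained[of n] n by auto
          have "?Q m"
          proof (intro conjI exI[of _ k] ballI)
            fix i assume i: "i \<in> {1..r}"
            show "partial_quotient_defined x (k i)"
              using k(2)[OF i] partial_quotient_irrational_unit(1)[OF irr] by blast
          qed (use n m k in fastforce)+
          then show "\<exists>n>n0. ?Q n" using n m by (intro exI[of _ m]) auto
        qed
        then have "x \<in> F_set r \<psi>" using x by (simp add: F_set_def frequently_cofinite)
        then show False using x by blast
      qed
    qed
    then have null: "{0..<1} - F_set r \<psi> \<in> null_sets lebesgue"
      using N(1) negligible_subset negligible_iff_null_sets by blast
    have F: "F_set r \<psi> = {0..<1} - ({0..<1} - F_set r \<psi>)" using F_sub by blast
    have "F_set r \<psi> \<in> sets lebesgue"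
      by (subst F, rule sets.Diff[OF _ null_setsD2[OF null]]) simp
    moreover have "emeasure lebesgue (F_set r \<psi>) = 1"
      by (subst F, subst emeasure_Diff_null_set[OF null]) simp_all
    ultimately show ?thesis using False unfolding sum_iff em sets by auto
  qed
qed

end
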